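(* Let $N, r, d$ be positive integers with $r > d+1$, and suppose we are given $N$ color classes of $r$ points of $\mathbb{R}^d$ each. Let $f(N)$ be the largest number of these color classes that a family $H_1,\ldots,H_r$ of half-spaces in $\mathbb{R}^d$ with empty intersection can split. Then: (1) there exists a colorful partition of the $Nr$ points into $r$ parts that remains a Tverberg partition even after the removal of any $t$ color classes, for any \[ t \le N - (1-q(r,d)) f(N) - \sqrt{\frac{(d+1)(r-1) f(N)\ln(N r^2)}{2}} - 1; \] (2) every colorful partition of the points into $r$ parts fails to be a Tverberg partition after the removal of a suitable set of at most $N - \frac{1}{r!} f(N)$ color classes.
   Context: Color classes are disjoint sets of points. A family of half-spaces $H_1,\ldots,H_r$ in $\mathbb{R}^d$ can split a set $X$ of $r$ points if (i) $H_1\cap\cdots\cap H_r=\emptyset$, and (ii) for each $k=1,\ldots,r$, the union of any $k$ of the half-spaces contains at least $k$ points of $X$ (so the points of $X$ can be labelled $x_1,\ldots,x_r$ with $x_i\in H_i$). A colorful partition of the union of the color classes is a partition into $r$ parts each containing exactly one point of each color class; it is a Tverberg partition if the convex hulls of the parts have a common point. Removing a color class means deleting all of its points from all parts. The quantity $q(r,d)$ is the minimum, over all $r\times r$ $\{0,1\}$-matrices $T$ such that every column has a nonzero entry and there are $d+1$ rows $i_1,\ldots,i_{d+1}$ such that every column has a nonzero entry in one of these rows, of the probability that a uniformly random permutation $\sigma$ of $[r]$ satisfies $T(i,\sigma(i))=1$ for some $i$. *)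

theory Defs
  imports "HOL-Analysis.Analysis" "HOL-Probability.Probability" "HOL-Combinatorics.Permutations"
begin

definition closed_halfspace :: "'a::euclidean_space set \<Rightarrow> bool" where
  "closed_halfspace S \<longleftrightarrow> (\<exists>a b. a \<noteq> 0 \<and> S = {x. a \<bullet> x \<le> b})"

(* Families are indexed by 0, ..., r - 1, so repeated half-spaces are allowed; values at
   indices >= r are ignored. *)

definition halfspace_family :: "nat \<Rightarrow> (nat \<Rightarrow> 'a::euclidean_space set) \<Rightarrow> bool" where
  "halfspace_family r H \<longleftrightarrow> (\<forall>i<r. closed_halfspace (H i))"

definition can_split :: "nat \<Rightarrow> (nat \<Rightarrow> 'a::euclidean_space set) \<Rightarrow> 'a set \<Rightarrow> bool" where
  "can_split r H X \<longleftrightarrow>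
     (\<Inter>i<r. H i) = {} \<and>
     (\<forall>k\<in>{1..r}. \<forall>K. K \<subseteq> {..<r} \<and> card K = k \<longrightarrow> k \<le> card (X \<inter> (\<Union>i\<in>K. H i)))"

definition color_classes :: "nat \<Rightarrow> nat \<Rightarrow> (nat \<Rightarrow> 'a set) \<Rightarrow> bool" where
  "color_classes N r C \<longleftrightarrow> disjoint_family_on C {..<N} \<and> (\<forall>j<N. finite (C j) \<and> card (C j) = r)"

(* The quantity f(N). The set under Max is bounded by N, and it is nonempty for r >= 2. *)

definition max_split :: "nat \<Rightarrow> nat \<Rightarrow> (nat \<Rightarrow> 'a::euclidean_space set) \<Rightarrow> nat" where
  "max_split N r C =
     Max {card {j \<in> {..<N}. can_split r H (C j)} | H.
            halfspace_family r H \<and> (\<Inter>i<r. H i) = {}}"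

definition colorful_partition ::
    "nat \<Rightarrow> nat \<Rightarrow> (nat \<Rightarrow> 'a set) \<Rightarrow> 'a set set \<Rightarrow> bool" where
  "colorful_partition N r C P \<longleftrightarrow>
     partition_on (\<Union>j<N. C j) P \<and> card P = r \<and> (\<forall>A\<in>P. \<forall>j<N. card (A \<inter> C j) = 1)"

definition is_tverberg :: "'a::real_vector set set \<Rightarrow> bool" where
  "is_tverberg P \<longleftrightarrow> (\<Inter>A\<in>P. convex hull A) \<noteq> {}"

definition remove_classes :: "(nat \<Rightarrow> 'a set) \<Rightarrow> nat set \<Rightarrow> 'a set set \<Rightarrow> 'a set set" where
  "remove_classes C R P = (\<lambda>A. A - (\<Union>j\<in>R. C j)) ` P"

(* r x r matrices with entries in {0,1}: only the entries T i j (row i, column j) with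
   i, j < r matter. *)

definition admissible_matrix :: "nat \<Rightarrow> nat \<Rightarrow> (nat \<Rightarrow> nat \<Rightarrow> nat) \<Rightarrow> bool" where
  "admissible_matrix r d T \<longleftrightarrow>
     (\<forall>i<r. \<forall>j<r. T i j \<in> {0, 1}) \<and>
     (\<forall>j<r. \<exists>i<r. T i j \<noteq> 0) \<and>
     (\<exists>I. I \<subseteq> {..<r} \<and> card I = d + 1 \<and> (\<forall>j<r. \<exists>i\<in>I. T i j \<noteq> 0))"

definition hit_prob :: "nat \<Rightarrow> (nat \<Rightarrow> nat \<Rightarrow> nat) \<Rightarrow> real" where
  "hit_prob r T =
     measure_pmf.prob (pmf_of_set {\<sigma>. \<sigma> permutes {..<r}}) {\<sigma>. \<exists>i<r. T i (\<sigma> i) = 1}"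

(* The set under Min is finite, since hit_prob r T is a multiple of 1 / r! in [0, 1], and it is
   nonempty iff r >= d + 1. *)

definition q :: "nat \<Rightarrow> nat \<Rightarrow> real" where
  "q r d = Min {hit_prob r T | T. admissible_matrix r d T}"

end

theory Submission
  imports Defs
begin

text \<open>
  Convex hulls of finite nonempty sets $A_0, \ldots, A_{r-1}$ have no common point iff there are
  $a_i$, $b_i$ with $\sum a_i = 0$, $\sum b_i = 0$ and $a_i \cdot x < b_i$ on $A_i$. Such pairs
  $(a, b)$ form a space of dimension $n = (d+1)(r-1)$, so by Sauer-Shelah they induce fewer than
  $(N r^2)^n$ different patterns on the $N r$ points and $r$ parts. In a uniformly random colorful
  partition, each pattern captures completely only classes that the half-spaces can split, hence at
  most $f(N)$ of them, each independently and, by Helly's theorem, with probability at most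
  $1 - q(r,d)$. Hoeffding's inequality and a union bound over the patterns give (1). For (2), Hall's
  theorem matches every split class to the half-spaces along some permutation of the parts, and one
  of the $r!$ permutations serves at least $f(N)/r!$ classes.
\<close>

subsection \<open>Separating families of convex sets\<close>

text \<open>For (1), a union bound over the sets of removed classes could have exponentially many
  terms in \<open>N\<close>. Instead, a failure is certified by a pattern from a family fixed before
  the random choice: if the surviving parts have no common point, one pattern captures every
  surviving class. A pattern is a set of pairs (point, index), so its universe has
  \<open>N * r * r\<close> elements; this is the \<open>N r^2\<close> under the logarithm. The two
  balance conditions remove \<open>d + 1\<close> of the \<open>(d + 1) * r\<close> parameters,
  whence \<open>r - 1\<close>. The square root is the deviation at which Hoeffding's bound for
  \<open>f(N)\<close> trials equals the reciprocal of \<open>(N r^2)^n\<close>. Patterns must be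
  open: with both sums equal to zero, only strict inequalities exclude a common point. The quantity
  \<open>f(N)\<close> is about closed half-spaces, so the hulls of the captured points have to be
  separated a second time.\<close>

lemma separating_functionals:
  fixes K :: "'i \<Rightarrow> 'a::euclidean_space set"
  assumes I: "finite I" and cvx: "\<And>i. i \<in> I \<Longrightarrow> convex (K i)" and cpt: "\<And>i. i \<in> I \<Longrightarrow> compact (K i)"
    and ne: "\<And>i. i \<in> I \<Longrightarrow> K i \<noteq> {}" and emp: "(\<Inter>i\<in>I. K i) = {}"
  obtains a p where "(\<Sum>i\<in>I. a i) = 0" "(\<Sum>i\<in>I. a i \<bullet> p i) < 0"
    "\<And>i x. i \<in> I \<Longrightarrow> x \<in> K i \<Longrightarrow> a i \<bullet> x \<le> a i \<bullet> p i"
proof -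
  define c where "c i x = closest_point (K i) x" for i x
  \<comment> \<open>A minimizer \<open>z\<close> of \<open>g\<close> supplies the functionals: the
    residuals \<open>z - c i z\<close> sum to zero by stationarity, each attains its maximum over
    \<open>K i\<close> at \<open>c i z\<close>, and the sum of these maxima is
    \<open>- g z < 0\<close>.\<close>
  define g where "g x = (\<Sum>i\<in>I. (norm (x - c i x))\<^sup>2)" for x
  have I0: "I \<noteq> {}" using emp by auto
  then obtain i0 where i0: "i0 \<in> I" by blast
  have cin: "c i x \<in> K i" if "i \<in> I" for i x
    unfolding c_def using closest_point_in_set[OF compact_imp_closed[OF cpt]] ne that by blast
  have cle: "norm (x - c i x) \<le> norm (x - y)" if "i \<in> I" "y \<in> K i" for i x y
    unfolding c_def using closest_point_le[OF compact_imp_closed[OF cpt], of i y x] that by (simp add: dist_norm)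
  have "bounded (\<Union>i\<in>I. K i)" using I cpt compact_imp_bounded by (intro bounded_UN) auto
  then obtain B where B: "B > 0" "\<And>i x. i \<in> I \<Longrightarrow> x \<in> K i \<Longrightarrow> norm x \<le> B"
    unfolding bounded_pos by blast
  \<comment> \<open>Outside this radius the distance to \<open>K i0\<close> alone exceeds
    \<open>card I * B\<close>, whose square bounds \<open>g 0\<close>; hence the minimum over the
    ball is global.\<close>
  define R where "R = B + real (card I) * B + 1"
  have R0: "R \<ge> 0" using B(1) by (simp add: R_def)
  have cont: "continuous_on S g" for S
    unfolding g_def c_def
    by (intro continuous_intros continuous_on_closest_point cvx compact_imp_closed cpt ne)
  have "\<exists>z\<in>cball 0 R. \<forall>y\<in>cball 0 R. g z \<le> g y"
    using R0 by (intro continuous_attains_inf cont) auto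
  then obtain z where z: "\<And>y. y \<in> cball 0 R \<Longrightarrow> g z \<le> g y" by blast
  have zmin: "g z \<le> g y" for y
  proof (cases "norm y \<le> R")
    case False
    have "g z \<le> g 0" using R0 by (intro z) auto
    also have "g 0 \<le> (\<Sum>i\<in>I. B\<^sup>2)"
      unfolding g_def by (intro sum_mono power_mono) (use B cin in auto)
    also have "\<dots> = real (card I) * B\<^sup>2" by simp
    also have "\<dots> \<le> (real (card I) * B)\<^sup>2"
    proof -
      have "1 \<le> real (card I)" using I I0 by (simp add: Suc_leI card_gt_0_iff)
      then have "real (card I) * 1 \<le> real (card I) * real (card I)" by (intro mult_left_mono) auto
      then show ?thesis
        using mult_right_mono[of "real (card I)" "real (card I) * real (card I)" "B * B"] B(1)
        by (simp add: power2_eq_square mult_ac)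
    qed
    also have "\<dots> \<le> (norm (y - c i0 y))\<^sup>2"
    proof (intro power_mono)
      have "norm y - norm (c i0 y) \<le> norm (y - c i0 y)" by (rule norm_triangle_ineq2)
      then show "real (card I) * B \<le> norm (y - c i0 y)"
        using False B(2)[OF i0 cin[OF i0, of y]] by (simp add: R_def)
    qed (use B(1) in auto)
    also have "\<dots> \<le> g y" unfolding g_def using I i0 by (intro member_le_sum) auto
    finally show ?thesis .
  qed (use z in auto)
  txt \<open>At a minimizer \<open>z\<close> of the sum of squared distances, moving against \<open>v\<close> cannot help.\<close>
  define a where "a i = z - c i z" for i
  define v where "v = (\<Sum>i\<in>I. a i)"
  \<comment> \<open>This step length minimizes \<open>- 2 * s * (v \<bullet> v) + card I *
    (s\<^sup>2 * (v \<bullet> v))\<close>, the upper bound for the change of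
    \<open>g\<close>.\<close>
  define s where "s = 1 / real (card I)"
  have cI: "real (card I) > 0" using I I0 by (simp add: card_gt_0_iff)
  have "(\<Sum>i\<in>I. (norm (a i))\<^sup>2) = g z" by (simp add: g_def a_def)
  also have "\<dots> \<le> g (z - s *\<^sub>R v)" by (rule zmin)
  also have "\<dots> \<le> (\<Sum>i\<in>I. (norm (a i - s *\<^sub>R v))\<^sup>2)"
  proof (unfold g_def, intro sum_mono power_mono)
    fix i assume "i \<in> I"
    show "norm (z - s *\<^sub>R v - c i (z - s *\<^sub>R v)) \<le> norm (a i - s *\<^sub>R v)"
      using cle[OF \<open>i \<in> I\<close> cin[OF \<open>i \<in> I\<close>, of z], of "z - s *\<^sub>R v"] by (simp add: a_def algebra_simps)
  qed auto
  also have "\<dots> = (\<Sum>i\<in>I. (norm (a i))\<^sup>2 - 2 * s * (a i \<bullet> v) + s\<^sup>2 * (v \<bullet> v))"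
    by (intro sum.cong refl)
       (simp only: power2_norm_eq_inner inner_diff_left inner_diff_right inner_scaleR_left
          inner_scaleR_right, simp add: inner_commute power2_eq_square algebra_simps)
  also have "\<dots> = (\<Sum>i\<in>I. (norm (a i))\<^sup>2) - 2 * s * (v \<bullet> v) + real (card I) * (s\<^sup>2 * (v \<bullet> v))"
    by (simp add: sum.distrib sum_subtractf v_def inner_sum_left sum_distrib_left)
  also have "real (card I) * (s\<^sup>2 * (v \<bullet> v)) = s * (v \<bullet> v)"
    using cI by (simp add: s_def power2_eq_square)
  finally have "s * (v \<bullet> v) \<le> 0" by simp
  then have "v \<bullet> v \<le> 0" using cI by (simp add: s_def field_simps)
  then have "v \<bullet> v = 0" using inner_ge_zero[of v] by linarith
  then have v0: "v = 0" by (simp only: inner_eq_zero_iff)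
  have "\<exists>i\<in>I. a i \<noteq> 0"
  proof (rule ccontr)
    assume "\<not> ?thesis"
    then have "z = c i z" if "i \<in> I" for i using that by (auto simp: a_def)
    then have "z \<in> (\<Inter>i\<in>I. K i)" using cin by (metis INT_I)
    then show False using emp by auto
  qed
  then obtain j where "j \<in> I" "a j \<noteq> 0" by blast
  then have "(\<Sum>i\<in>I. a i \<bullet> a i) > 0" by (intro sum_pos2[OF I, of j]) auto
  moreover have "(\<Sum>i\<in>I. a i \<bullet> c i z) = v \<bullet> z - (\<Sum>i\<in>I. a i \<bullet> a i)"
  proof -
    have "(\<Sum>i\<in>I. a i \<bullet> c i z) = (\<Sum>i\<in>I. a i \<bullet> z - a i \<bullet> a i)"
      by (intro sum.cong refl) (simp add: a_def inner_diff_right)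
    then show ?thesis by (simp add: v_def inner_sum_left sum_subtractf)
  qed
  ultimately have neg: "(\<Sum>i\<in>I. a i \<bullet> c i z) < 0" using v0 by simp
  have "a i \<bullet> x \<le> a i \<bullet> c i z" if "i \<in> I" "x \<in> K i" for i x
    using closest_point_dot[OF cvx[OF that(1)] compact_imp_closed[OF cpt[OF that(1)]] that(2), of z]
    by (simp add: a_def c_def inner_diff_right)
  then show ?thesis using that[of a "\<lambda>i. c i z"] v0 neg by (simp add: v_def)
qed

lemma separating_open_halfspaces:
  fixes K :: "'i \<Rightarrow> 'a::euclidean_space set"
  assumes I: "finite I" and "\<And>i. i \<in> I \<Longrightarrow> convex (K i)" and "\<And>i. i \<in> I \<Longrightarrow> compact (K i)"
    and "\<And>i. i \<in> I \<Longrightarrow> K i \<noteq> {}" and emp: "(\<Inter>i\<in>I. K i) = {}"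
  obtains a b where "(\<Sum>i\<in>I. a i) = 0" "(\<Sum>i\<in>I. b i) = 0"
    "\<And>i x. i \<in> I \<Longrightarrow> x \<in> K i \<Longrightarrow> a i \<bullet> x < b i"
proof -
  obtain a p where a: "(\<Sum>i\<in>I. a i) = 0" "(\<Sum>i\<in>I. a i \<bullet> p i) < 0"
    "\<And>i x. i \<in> I \<Longrightarrow> x \<in> K i \<Longrightarrow> a i \<bullet> x \<le> a i \<bullet> p i"
    using separating_functionals[of I K] assms by blast
  \<comment> \<open>Subtracting the mean \<open>e\<close> from all thresholds makes them sum to
    zero; since \<open>e < 0\<close>, this raises each of them and turns the weak inequalities into
    strict ones.\<close>
  define e where "e = (\<Sum>i\<in>I. a i \<bullet> p i) / card I"
  have "I \<noteq> {}" using emp by auto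
  then have c: "real (card I) > 0" using I by (simp add: card_gt_0_iff)
  have "e < 0" unfolding e_def using a(2) c by (simp add: divide_neg_pos)
  moreover have "(\<Sum>i\<in>I. a i \<bullet> p i - e) = 0" using c by (simp add: sum_subtractf e_def)
  ultimately show ?thesis using that[of a "\<lambda>i. a i \<bullet> p i - e"] a by force
qed

text \<open>Traces come from open and possibly degenerate half-spaces, whereas
  \<open>max_split\<close> asks for closed ones with nonzero normal. This version leads back to the
  latter.\<close>

lemma separating_closed_halfspaces:
  fixes K :: "nat \<Rightarrow> 'a::euclidean_space set"
  assumes cvx: "\<And>i. i < r \<Longrightarrow> convex (K i)" and cpt: "\<And>i. i < r \<Longrightarrow> compact (K i)"
    and ne: "\<And>i. i < r \<Longrightarrow> K i \<noteq> {}" and emp: "(\<Inter>i<r. K i) = {}"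
  obtains H where "halfspace_family r H" "(\<Inter>i<r. H i) = {}" "\<And>i. i < r \<Longrightarrow> K i \<subseteq> H i"
proof -
  obtain a p where a: "(\<Sum>i<r. a i) = 0" "(\<Sum>i<r. a i \<bullet> p i) < 0"
    "\<And>i x. i < r \<Longrightarrow> x \<in> K i \<Longrightarrow> a i \<bullet> x \<le> a i \<bullet> p i"
    using separating_functionals[of "{..<r}" K] assms by auto
  have "\<exists>h. closed_halfspace h \<and> K i \<subseteq> h \<and> (a i \<noteq> 0 \<longrightarrow> h = {x. a i \<bullet> x \<le> a i \<bullet> p i})"
    if i: "i < r" for i
  proof (cases "a i = 0")
    txt \<open>The \<open>i\<close>-th functional is trivial and plays no role in making the intersection empty, so any
      half-space containing \<open>K i\<close> will do.\<close>
    case True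
    obtain e :: 'a where e: "e \<in> Basis" using nonempty_Basis by blast
    obtain B where B: "\<And>x. x \<in> K i \<Longrightarrow> norm x \<le> B"
      using compact_imp_bounded[OF cpt[OF i]] unfolding bounded_iff by blast
    have "e \<bullet> x \<le> B" if x: "x \<in> K i" for x
      using B[OF x] Basis_le_norm[OF e, of x] by (simp add: inner_commute)
    moreover have "e \<noteq> 0" using e by auto
    ultimately show ?thesis using True unfolding closed_halfspace_def
      by (intro exI[of _ "{x. e \<bullet> x \<le> B}"]) auto
  next
    case False
    then show ?thesis using a(3)[OF i] unfolding closed_halfspace_def
      by (intro exI[of _ "{x. a i \<bullet> x \<le> a i \<bullet> p i}"]) auto
  qed
  then obtain H where H: "\<And>i. i < r \<Longrightarrow> closed_halfspace (H i) \<and> K i \<subseteq> H i \<and>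
      (a i \<noteq> 0 \<longrightarrow> H i = {x. a i \<bullet> x \<le> a i \<bullet> p i})" by metis
  have "x \<notin> (\<Inter>i<r. H i)" for x
  proof
    assume x: "x \<in> (\<Inter>i<r. H i)"
    have "a i \<bullet> x \<le> a i \<bullet> p i" if "i < r" for i
      using H[OF that] x that by (cases "a i = 0") auto
    then have "(\<Sum>i<r. a i \<bullet> x) \<le> (\<Sum>i<r. a i \<bullet> p i)" by (intro sum_mono) auto
    then show False using a(1,2) by (simp flip: inner_sum_left)
  qed
  then have "(\<Inter>i<r. H i) = {}" by blast
  then show ?thesis using that[of H] H by (auto simp: halfspace_family_def)
qed

subsection \<open>Linear dependence and the Sauer-Shelah lemma\<close>

text \<open>Gaussian elimination: multiples of a pivot \<open>w z\<close> with nonzero coordinate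
  \<open>e\<close> clear that coordinate from the other vectors. A dependence of the reduced vectors
  extends to \<open>z\<close>, with the coefficient forced by coordinate \<open>e\<close>.\<close>

lemma linear_dependence:
  fixes w :: "'x \<Rightarrow> 'e \<Rightarrow> real"
  assumes "finite E" "finite X" "card E < card X"
  obtains c where "\<exists>x\<in>X. c x \<noteq> 0" "\<And>e. e \<in> E \<Longrightarrow> (\<Sum>x\<in>X. c x * w x e) = 0"
  using assms
proof (induction E arbitrary: X w thesis rule: finite_induct)
  case empty
  then have "X \<noteq> {}" by auto
  then show ?case using empty.prems(1)[of "\<lambda>_. 1"] by auto
next
  case (insert e E)
  show ?case
  proof (cases "\<forall>x\<in>X. w x e = 0")
    case True
    obtain c where "\<exists>x\<in>X. c x \<noteq> 0" "\<And>e. e \<in> E \<Longrightarrow> (\<Sum>x\<in>X. c x * w x e) = 0"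
      using insert.IH[of X w] insert.prems(2,3) insert.hyps(1,2) by (metis Suc_lessD card_insert_disjoint)
    moreover from this have "(\<Sum>x\<in>X. c x * w x f) = 0" if "f \<in> insert e E" for f
      using True that by (cases "f = e") simp_all
    ultimately show ?thesis using insert.prems(1)[of c] by blast
  next
    case False
    then obtain z where z: "z \<in> X" "w z e \<noteq> 0" by blast
    define X' where "X' = X - {z}"
    have X: "X = insert z X'" "z \<notin> X'" "finite X'" using z insert.prems(2) by (auto simp: X'_def)
    have "card E < card X'" using insert.prems(3) insert.hyps(1,2) X by simp
    then obtain c where c: "\<exists>x\<in>X'. c x \<noteq> 0"
      "\<And>f. f \<in> E \<Longrightarrow> (\<Sum>x\<in>X'. c x * (w x f - w x e / w z e * w z f)) = 0"
      using insert.IH[of X' "\<lambda>x f. w x f - w x e / w z e * w z f"] X(3) by blast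
    define k where "k = - (\<Sum>x\<in>X'. c x * w x e) / w z e"
    have rest: "(\<Sum>x\<in>X'. (c(z := k)) x * w x f) = (\<Sum>x\<in>X'. c x * w x f)" for f
      using X(2) by (intro sum.cong) auto
    have "(\<Sum>x\<in>X. (c(z := k)) x * w x f) = 0" if "f \<in> insert e E" for f
    proof (cases "f = e")
      case True
      then show ?thesis unfolding X(1) sum.insert[OF X(3,2)] rest using z by (simp add: k_def)
    next
      case False
      then have "(\<Sum>x\<in>X'. c x * w x f) = (\<Sum>x\<in>X'. c x * (w x e / w z e * w z f))"
        using c(2)[of f] that by (simp add: right_diff_distrib sum_subtractf)
      also have "\<dots> = - (k * w z f)"
        by (simp add: k_def sum_distrib_right sum_divide_distrib flip: sum_negf) (simp add: mult_ac)
      finally show ?thesis unfolding X(1) sum.insert[OF X(3,2)] rest by simp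
    qed
    moreover have "\<exists>x\<in>X. (c(z := k)) x \<noteq> 0" using c(1) X by auto
    ultimately show ?thesis using insert.prems(1)[of "c(z := k)"] by blast
  qed
qed

definition shatters :: "'a set set \<Rightarrow> 'a set \<Rightarrow> bool" where
  "shatters F S \<longleftrightarrow> (\<forall>A\<subseteq>S. \<exists>B\<in>F. B \<inter> S = A)"

text \<open>Pajor's form of the Sauer-Shelah lemma. Counting shattered sets instead of bounding a
  dimension makes the induction on the ground set go through directly.\<close>

lemma card_le_card_shattered:
  assumes "finite U" "F \<subseteq> Pow U"
  shows "card F \<le> card {S. S \<subseteq> U \<and> shatters F S}"
  using assms
proof (induction U arbitrary: F rule: finite_induct)
  case empty
  show ?case
  proof (cases "F = {}")
    case False
    with empty have "F = {{}}" by auto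
    then have "{S. S \<subseteq> {} \<and> shatters F S} = {{}}" by (auto simp: shatters_def)
    with \<open>F = {{}}\<close> show ?thesis by simp
  qed simp
next
  case (insert x U)
  define F0 where "F0 = {A \<in> F. x \<notin> A}"
  define F1 where "F1 = (\<lambda>A. A - {x}) ` {A \<in> F. x \<in> A}"
  define sh where "sh G = {S. S \<subseteq> U \<and> shatters G S}" for G
  have finF: "finite F" using insert.prems insert.hyps by (meson finite_Pow_iff finite_insert finite_subset)
  have finsh: "finite (sh G)" for G using insert.hyps by (simp add: sh_def)
  have "card F = card (F0 \<union> {A \<in> F. x \<in> A})" by (rule arg_cong[of _ _ card]) (auto simp: F0_def)
  also have "\<dots> = card F0 + card {A \<in> F. x \<in> A}" using finF by (subst card_Un_disjoint) (auto simp: F0_def)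
  also have "card {A \<in> F. x \<in> A} = card F1"
    unfolding F1_def by (rule card_image[symmetric]) (auto simp: inj_on_def)
  also have "card F0 \<le> card (sh F0)" unfolding sh_def
    by (rule insert.IH) (use insert.prems in \<open>auto simp: F0_def\<close>)
  also have "card F1 \<le> card (sh F1)" unfolding sh_def
    by (rule insert.IH) (use insert.prems in \<open>auto simp: F1_def\<close>)
  \<comment> \<open>A set shattered by both \<open>F0\<close> and \<open>F1\<close> has to count
    twice; the second copy is the same set with \<open>x\<close> added, which \<open>F\<close>
    shatters too.\<close>
  also have "card (sh F0) + card (sh F1) = card (sh F0 \<union> sh F1) + card (insert x ` (sh F0 \<inter> sh F1))"
  proof -
    have "inj_on (insert x) (sh F0 \<inter> sh F1)"
      using insert.hyps by (auto simp: inj_on_def sh_def insert_ident)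
    then show ?thesis using card_Un_Int[OF finsh finsh] by (simp add: card_image)
  qed
  also have "\<dots> = card ((sh F0 \<union> sh F1) \<union> insert x ` (sh F0 \<inter> sh F1))"
    using finsh insert.hyps by (intro card_Un_disjoint[symmetric]) (auto simp: sh_def)
  also have "\<dots> \<le> card {S. S \<subseteq> insert x U \<and> shatters F S}"
  proof (intro card_mono)
    show "finite {S. S \<subseteq> insert x U \<and> shatters F S}" using insert.hyps by simp
    have 0: "shatters F S" if "S \<subseteq> U" "shatters F0 S" for S
      using that unfolding shatters_def F0_def by blast
    have 1: "shatters F S" if S: "S \<subseteq> U" "shatters F1 S" for S
      unfolding shatters_def
    proof (intro allI impI)
      fix A assume "A \<subseteq> S"
      then obtain B where "B \<in> F" "x \<in> B" "(B - {x}) \<inter> S = A"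
        using S(2) unfolding shatters_def F1_def by blast
      then show "\<exists>B\<in>F. B \<inter> S = A" using S(1) insert.hyps by blast
    qed
    have 2: "shatters F (insert x S)" if S: "S \<subseteq> U" "shatters F0 S" "shatters F1 S" for S
      unfolding shatters_def
    proof (intro allI impI)
      fix A assume A: "A \<subseteq> insert x S"
      show "\<exists>B\<in>F. B \<inter> insert x S = A"
      proof (cases "x \<in> A")
        case True
        have "A - {x} \<subseteq> S" using A by blast
        then obtain B where "B \<in> F" "x \<in> B" "(B - {x}) \<inter> S = A - {x}"
          using S(3) unfolding shatters_def F1_def by blast
        moreover from this have "B \<inter> insert x S = A" using True S(1) insert.hyps by blast
        ultimately show ?thesis by blast
      next
        case False
        then obtain B where "B \<in> F" "x \<notin> B" "B \<inter> S = A"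
          using S(2) A unfolding shatters_def F0_def by blast
        then show ?thesis by blast
      qed
    qed
    show "(sh F0 \<union> sh F1) \<union> insert x ` (sh F0 \<inter> sh F1) \<subseteq> {S. S \<subseteq> insert x U \<and> shatters F S}"
      using 0 1 2 by (auto simp: sh_def)
  qed
  finally show ?case by simp
qed

lemma shatters_subset: "shatters F S \<Longrightarrow> T \<subseteq> S \<Longrightarrow> shatters F T"
  unfolding shatters_def
proof (intro allI impI)
  fix A assume h: "\<forall>A\<subseteq>S. \<exists>B\<in>F. B \<inter> S = A" "T \<subseteq> S" "A \<subseteq> T"
  then obtain B where "B \<in> F" "B \<inter> S = A" by (meson order_trans)
  then show "\<exists>B\<in>F. B \<inter> T = A" using h by blast
qed

lemma sauer_shelah:
  assumes U: "finite U" "F \<subseteq> Pow U"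
    and n: "\<And>S. S \<subseteq> U \<Longrightarrow> card S = n + 1 \<Longrightarrow> \<not> shatters F S"
  shows "card F \<le> (\<Sum>i\<le>n. card U choose i)"
proof -
  have "card F \<le> card {S. S \<subseteq> U \<and> shatters F S}" by (rule card_le_card_shattered[OF U])
  also have "\<dots> \<le> card (\<Union>i\<le>n. {S. S \<subseteq> U \<and> card S = i})"
  proof (intro card_mono)
    show "{S. S \<subseteq> U \<and> shatters F S} \<subseteq> (\<Union>i\<le>n. {S. S \<subseteq> U \<and> card S = i})"
    proof clarsimp
      fix S assume S: "S \<subseteq> U" "shatters F S"
      show "card S \<le> n"
      proof (rule ccontr)
        assume "\<not> card S \<le> n"
        then obtain T where "T \<subseteq> S" "card T = n + 1"
          using obtain_subset_with_card_n[of "n + 1" S] by auto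
        then show False using n[of T] S shatters_subset[of F S T] by auto
      qed
    qed
  qed (use U in auto)
  also have "\<dots> \<le> (\<Sum>i\<le>n. card {S. S \<subseteq> U \<and> card S = i})" by (rule card_UN_le) simp
  also have "\<dots> = (\<Sum>i\<le>n. card U choose i)" using U(1) by (simp add: n_subsets)
  finally show ?thesis .
qed

text \<open>The strict inequality is what brings the union bound over the traces below 1. In the
  step, the new binomial coefficient and the old power each take at most half of
  \<open>m ^ Suc n\<close>.\<close>

lemma sum_choose_less_power:
  assumes "4 \<le> m" "2 \<le> n"
  shows "(\<Sum>i\<le>n. m choose i) < m ^ n"
  using assms(2)
proof (induction n rule: nat_induct_at_least)
  case base
  have "2 * (m choose 2) \<le> m ^ 2" using binomial_fact_pow[of m 2] by (simp add: fact_2 mult.commute)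
  moreover have "(\<Sum>i\<le>2. m choose i) = 1 + m + (m choose 2)" by (simp add: numeral_2_eq_2)
  moreover have "4 * m \<le> m ^ 2" using assms(1) by (simp add: power2_eq_square)
  ultimately have "(\<Sum>i\<le>2. m choose i) < m ^ 2" using assms(1) by linarith
  then show ?case by simp
next
  case (Suc n)
  have "m choose Suc n \<le> m ^ Suc n div 2"
  proof -
    have "fact (Suc n) * (m choose Suc n) \<le> m ^ Suc n" by (rule binomial_fact_pow[simplified mult.commute])
    moreover have "2 \<le> (fact (Suc n) :: nat)" using Suc(1) fact_mono_nat[of 2 "Suc n"] by simp
    ultimately have "2 * (m choose Suc n) \<le> m ^ Suc n" by (meson mult_le_mono1 order_trans)
    then show ?thesis by simp
  qed
  moreover have "m ^ n \<le> m ^ Suc n div 2"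
  proof -
    have "2 * m ^ n \<le> m * m ^ n" using assms(1) by (intro mult_le_mono1) simp
    then show ?thesis unfolding power_Suc by linarith
  qed
  moreover have "2 * (m ^ Suc n div 2) \<le> m ^ Suc n" by simp
  ultimately show ?case using Suc by (simp only: sum.atMost_Suc)
qed

subsection \<open>Hall's theorem and Helly's theorem\<close>

text \<open>Induction on \<open>card I\<close>. If a nonempty proper subfamily \<open>K\<close> is
  tight, it is matched inside its union \<open>T\<close> and the rest outside \<open>T\<close>.
  Otherwise every such subfamily has an element to spare, so any \<open>y\<close> in
  \<open>S i\<close> may be given to \<open>i\<close> and deleted elsewhere.\<close>

theorem hall:
  fixes S :: "'i \<Rightarrow> 'b set"
  assumes "finite I" "\<And>i. i \<in> I \<Longrightarrow> finite (S i)" "\<And>K. K \<subseteq> I \<Longrightarrow> card K \<le> card (\<Union>i\<in>K. S i)"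
  shows "\<exists>f. inj_on f I \<and> (\<forall>i\<in>I. f i \<in> S i)"
  using assms
proof (induction "card I" arbitrary: I S rule: less_induct)
  case less
  have fin: "finite (\<Union>i\<in>K. S i)" if "K \<subseteq> I" for K
    using less.prems(2) that finite_subset[OF that less.prems(1)] by (intro finite_UN_I) auto
  show ?case
  proof (cases "I = {}")
    case False
    then obtain i where i: "i \<in> I" by blast
    show ?thesis
    proof (cases "\<exists>K\<subset>I. K \<noteq> {} \<and> card K = card (\<Union>i\<in>K. S i)")
      case True
      then obtain K where K: "K \<subset> I" "K \<noteq> {}" "card K = card (\<Union>i\<in>K. S i)" by blast
      define T where "T = (\<Union>i\<in>K. S i)"
      have finK: "finite K" using K(1) less.prems(1) by (meson finite_subset psubset_imp_subset)
      have finT: "finite T" unfolding T_def using K(1) by (intro fin) blast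
      have "\<exists>f. inj_on f K \<and> (\<forall>i\<in>K. f i \<in> S i)"
      proof (rule less.hyps)
        show "card K < card I" using K(1) less.prems(1) by (intro psubset_card_mono)
        show "finite (S i)" if "i \<in> K" for i using that K(1) less.prems(2) by blast
        show "card L \<le> card (\<Union>i\<in>L. S i)" if "L \<subseteq> K" for L
          using that K(1) by (intro less.prems(3)) blast
      qed (rule finK)
      then obtain f where f: "inj_on f K" "\<forall>i\<in>K. f i \<in> S i" by blast
      have "\<exists>g. inj_on g (I - K) \<and> (\<forall>i\<in>I - K. g i \<in> S i - T)"
      proof (rule less.hyps)
        show "card (I - K) < card I" using K less.prems(1) by (intro psubset_card_mono) auto
        fix L assume L: "L \<subseteq> I - K"
        then have finL: "finite L" using less.prems(1) finite_subset by blast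
        have "card L + card K = card (L \<union> K)" using L finL finK by (subst card_Un_disjoint) auto
        also have "\<dots> \<le> card (\<Union>i\<in>L \<union> K. S i)" using L K by (intro less.prems(3)) auto
        also have "(\<Union>i\<in>L \<union> K. S i) = (\<Union>i\<in>L. S i - T) \<union> T" by (auto simp: T_def)
        also have "card \<dots> = card (\<Union>i\<in>L. S i - T) + card T"
          using L finL finT less.prems(2) by (intro card_Un_disjoint) auto
        finally show "card L \<le> card (\<Union>i\<in>L. S i - T)" using K(3) by (simp add: T_def)
      qed (use less.prems(1,2) in auto)
      then obtain g where g: "inj_on g (I - K)" "\<forall>i\<in>I - K. g i \<in> S i - T" by blast
      define h where "h i = (if i \<in> K then f i else g i)" for i
      have "h i \<in> S i" if "i \<in> I" for i using that f(2) g(2) by (auto simp: h_def)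
      moreover have "inj_on h I"
      proof (rule inj_onI)
        fix x y assume xy: "x \<in> I" "y \<in> I" "h x = h y"
        have "h z \<in> T \<longleftrightarrow> z \<in> K" if "z \<in> I" for z using that f(2) g(2) by (auto simp: h_def T_def)
        then have "x \<in> K \<longleftrightarrow> y \<in> K" using xy by metis
        then show "x = y" using xy f(1) g(1) by (auto simp: h_def inj_on_def split: if_splits)
      qed
      ultimately show ?thesis by blast
    next
      case no: False
      have "card {i} \<le> card (\<Union>j\<in>{i}. S j)" using i by (intro less.prems(3)) auto
      then obtain y where y: "y \<in> S i" by fastforce
      have "\<exists>f. inj_on f (I - {i}) \<and> (\<forall>j\<in>I - {i}. f j \<in> S j - {y})"
      proof (rule less.hyps)
        show "card (I - {i}) < card I" using i less.prems(1) by (intro psubset_card_mono) auto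
        fix K assume K: "K \<subseteq> I - {i}"
        show "card K \<le> card (\<Union>j\<in>K. S j - {y})"
        proof (cases "K = {}")
          case False
          have "K \<subset> I" using K i by blast
          then have "card K \<noteq> card (\<Union>j\<in>K. S j)" using no False by blast
          moreover have "card K \<le> card (\<Union>j\<in>K. S j)" using \<open>K \<subset> I\<close> by (intro less.prems(3)) blast
          ultimately have "card K \<le> card (\<Union>j\<in>K. S j) - 1" by linarith
          also have "\<dots> \<le> card ((\<Union>j\<in>K. S j) - {y})" using diff_card_le_card_Diff[of "{y}" "\<Union>j\<in>K. S j"] by simp
          also have "(\<Union>j\<in>K. S j) - {y} = (\<Union>j\<in>K. S j - {y})" by blast
          finally show ?thesis .
        qed simp
      qed (use less.prems(1,2) in auto)
      then obtain f where f: "inj_on f (I - {i})" "\<forall>j\<in>I - {i}. f j \<in> S j - {y}" by blast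
      have "inj_on (f(i := y)) I" using f i by (auto simp: inj_on_def)
      moreover have "\<forall>j\<in>I. (f(i := y)) j \<in> S j" using f y by auto
      ultimately show ?thesis by blast
    qed
  qed simp
qed

text \<open>An injective choice of \<open>r\<close> points from a class of \<open>r\<close> points
  exhausts the class, so Hall's matching is a bijection. Both halves of the theorem use splitting in
  this form.\<close>

lemma can_split_iff:
  assumes "finite X" "card X = r"
  shows "can_split r H X \<longleftrightarrow>
    (\<Inter>i<r. H i) = {} \<and> (\<exists>f. bij_betw f {..<r} X \<and> (\<forall>i<r. f i \<in> H i))"
proof (intro iffI conjI)
  assume s: "can_split r H X"
  then show "(\<Inter>i<r. H i) = {}" by (simp add: can_split_def)
  have "\<exists>f. inj_on f {..<r} \<and> (\<forall>i\<in>{..<r}. f i \<in> X \<inter> H i)"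
  proof (rule hall)
    fix K assume K: "K \<subseteq> {..<r}"
    then have "card K \<le> r" using card_mono[OF _ K] by simp
    have "card K \<le> card (X \<inter> (\<Union>i\<in>K. H i))"
    proof (cases "card K = 0")
      case False
      then have "card K \<in> {1..r}" using \<open>card K \<le> r\<close> by simp
      then show ?thesis using conjunct2[OF s[unfolded can_split_def], rule_format] K by simp
    qed simp
    then show "card K \<le> card (\<Union>i\<in>K. X \<inter> H i)" by (simp only: Int_UN_distrib)
  qed (use assms in auto)
  then obtain f where f: "inj_on f {..<r}" "\<forall>i\<in>{..<r}. f i \<in> X \<inter> H i" by blast
  moreover have "f ` {..<r} = X"
    using f assms by (intro card_subset_eq) (auto simp: card_image)
  ultimately show "\<exists>f. bij_betw f {..<r} X \<and> (\<forall>i<r. f i \<in> H i)" by (auto simp: bij_betw_def)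
next
  assume h: "(\<Inter>i<r. H i) = {} \<and> (\<exists>f. bij_betw f {..<r} X \<and> (\<forall>i<r. f i \<in> H i))"
  then obtain f where f: "bij_betw f {..<r} X" "\<forall>i<r. f i \<in> H i" by blast
  show "can_split r H X" unfolding can_split_def
  proof (intro conjI ballI allI impI)
    fix k K assume K: "K \<subseteq> {..<r} \<and> card K = k"
    then have "k = card (f ` K)"
      using f(1) by (metis bij_betw_def card_image inj_on_subset)
    also have "\<dots> \<le> card (X \<inter> (\<Union>i\<in>K. H i))"
      using K f assms(1) by (intro card_mono) (auto simp: bij_betw_def)
    finally show "k \<le> card (X \<inter> (\<Union>i\<in>K. H i))" .
  qed (use h in blast)
qed

text \<open>Helly's theorem speaks of a set of sets, but \<open>admissible_matrix\<close> needs
  exactly \<open>d + 1\<close> row indices and half-spaces may repeat. Hence one index is chosen for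
  each set, and the index set is padded to the required size.\<close>

lemma indexed_Helly:
  fixes S :: "nat \<Rightarrow> 'a::euclidean_space set"
  assumes cvx: "\<And>i. i < r \<Longrightarrow> convex (S i)" and emp: "(\<Inter>i<r. S i) = {}" and r: "DIM('a) + 1 \<le> r"
  obtains I where "I \<subseteq> {..<r}" "card I = DIM('a) + 1" "(\<Inter>i\<in>I. S i) = {}"
proof -
  define F where "F = S ` {..<r}"
  have "\<exists>t\<subseteq>F. \<Inter>t = {} \<and> card t \<le> DIM('a) + 1"
  proof (cases "card F \<ge> DIM('a) + 1")
    case True
    have "\<Inter>F = {}" "\<forall>s\<in>F. convex s" using emp cvx by (auto simp: F_def)
    then obtain t where "t \<subseteq> F" "card t = DIM('a) + 1" "\<Inter>t = {}" using Helly[of F] True by blast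
    then show ?thesis by (intro exI[of _ t]) simp
  next
    case False
    then show ?thesis using emp by (intro exI[of _ F]) (auto simp: F_def)
  qed
  then obtain t where t: "t \<subseteq> F" "\<Inter>t = {}" "card t \<le> DIM('a) + 1" by blast
  then obtain J where J: "J \<subseteq> {..<r}" "inj_on S J" "t = S ` J"
    unfolding F_def by (meson subset_image_inj)
  have "card J \<le> DIM('a) + 1" using t J by (simp add: card_image)
  then obtain I where "J \<subseteq> I" "I \<subseteq> {..<r}" "card I = DIM('a) + 1"
    using exists_subset_between[of J "DIM('a) + 1" "{..<r}"] J r by auto
  moreover from this have "(\<Inter>i\<in>I. S i) = {}" using t(2) J(3) by blast
  ultimately show ?thesis using that by blast
qed

subsection \<open>Half-space patterns\<close>

text \<open>All points are compared with all \<open>r\<close> half-spaces, whichever part they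
  belong to, so the family of traces does not depend on the partition.\<close>

definition open_trace :: "nat \<Rightarrow> 'a::euclidean_space set \<Rightarrow> (nat \<Rightarrow> 'a) \<Rightarrow> (nat \<Rightarrow> real) \<Rightarrow> ('a \<times> nat) set"
  where "open_trace r X a b = {(x, i). x \<in> X \<and> i < r \<and> a i \<bullet> x < b i}"

definition traces :: "nat \<Rightarrow> 'a::euclidean_space set \<Rightarrow> ('a \<times> nat) set set"
  where "traces r X = {open_trace r X a b | a b. (\<Sum>i<r. a i) = 0 \<and> (\<Sum>i<r. b i) = 0}"

text \<open>The balance conditions eliminate \<open>a 0\<close> and \<open>b 0\<close>, which leaves \<open>(DIM('a) + 1) * (r - 1)\<close>
  free parameters; \<open>None\<close> is the coordinate that carries \<open>b\<close>.\<close>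

definition trace_coord :: "'a::euclidean_space \<times> nat \<Rightarrow> 'a option \<times> nat \<Rightarrow> real"
  where "trace_coord s e = (of_bool (snd s = snd e) - of_bool (snd s = 0)) *
    (case fst e of None \<Rightarrow> -1 | Some u \<Rightarrow> fst s \<bullet> u)"

text \<open>Write \<open>L k\<close> for \<open>a k \<bullet> x - b k\<close>. Balance gives
  \<open>L 0 = - (\<Sum>k\<in>{1..<r}. L k)\<close>, and the factor
  \<open>of_bool (i = k) - of_bool (i = 0)\<close> treats this case and \<open>L i\<close> with
  \<open>i > 0\<close> uniformly.\<close>

lemma functional_eq_sum_trace_coord:
  fixes a :: "nat \<Rightarrow> 'a::euclidean_space"
  assumes a: "(\<Sum>i<r. a i) = 0" and b: "(\<Sum>i<r. b i) = 0" and i: "i < r"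
  shows "a i \<bullet> x - b i = (\<Sum>e\<in>insert None (Some ` Basis) \<times> {1..<r}.
    trace_coord (x, i) e * (case fst e of None \<Rightarrow> b (snd e) | Some u \<Rightarrow> a (snd e) \<bullet> u))"
proof -
  define L where "L k = a k \<bullet> x - b k" for k
  define d :: "nat \<Rightarrow> real" where "d k = of_bool (i = k) - of_bool (i = 0)" for k
  have "(\<Sum>k<r. L k) = 0"
    using a b by (simp add: L_def sum_subtractf flip: inner_sum_left)
  moreover have "{..<r} = insert 0 {1..<r}" using i by auto
  ultimately have L0: "L 0 = - (\<Sum>k\<in>{1..<r}. L k)" by simp
  have "(\<Sum>e\<in>insert None (Some ` Basis) \<times> {1..<r}.
      trace_coord (x, i) e * (case fst e of None \<Rightarrow> b (snd e) | Some u \<Rightarrow> a (snd e) \<bullet> u))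
    = (\<Sum>y\<in>insert None (Some ` Basis). \<Sum>k\<in>{1..<r}.
      d k * (case y of None \<Rightarrow> - b k | Some u \<Rightarrow> (x \<bullet> u) * (a k \<bullet> u)))"
    unfolding sum.cartesian_product
    by (intro sum.cong refl) (auto simp: trace_coord_def d_def split: option.split)
  also have "\<dots> = (\<Sum>k\<in>{1..<r}. \<Sum>y\<in>insert None (Some ` Basis).
      d k * (case y of None \<Rightarrow> - b k | Some u \<Rightarrow> (x \<bullet> u) * (a k \<bullet> u)))"
    by (rule sum.swap)
  also have "\<dots> = (\<Sum>k\<in>{1..<r}. d k * L k)"
  proof (intro sum.cong refl)
    fix k
    have "(\<Sum>y\<in>insert None (Some ` Basis). case y of None \<Rightarrow> - b k | Some u \<Rightarrow> (x \<bullet> u) * (a k \<bullet> u))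
      = - b k + (\<Sum>u\<in>Basis. (x \<bullet> u) * (a k \<bullet> u))"
      by (subst sum.insert) (auto simp: sum.reindex)
    also have "(\<Sum>u\<in>Basis. (x \<bullet> u) * (a k \<bullet> u)) = a k \<bullet> x"
      by (subst euclidean_inner[of "a k" x]) (simp add: mult.commute)
    finally show "(\<Sum>y\<in>insert None (Some ` Basis).
        d k * (case y of None \<Rightarrow> - b k | Some u \<Rightarrow> (x \<bullet> u) * (a k \<bullet> u))) = d k * L k"
      by (simp add: L_def flip: sum_distrib_left)
  qed
  also have "\<dots> = L i"
  proof (cases "i = 0")
    case True
    then have "(\<Sum>k\<in>{1..<r}. d k * L k) = (\<Sum>k\<in>{1..<r}. - L k)"
      by (intro sum.cong) (auto simp: d_def)
    then show ?thesis using L0 True by (simp add: sum_negf)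
  next
    case False
    then have "(\<Sum>k\<in>{1..<r}. d k * L k) = (\<Sum>k\<in>{1..<r}. if k = i then L k else 0)"
      by (intro sum.cong) (auto simp: d_def)
    then show ?thesis using False i by simp
  qed
  finally show ?thesis by (simp add: L_def)
qed

text \<open>Each pair in \<open>S\<close> gives a linear functional of the parameters
  \<open>(a, b)\<close>, and one more functional than the dimension of the parameter space forces a
  linear dependence among them.\<close>

lemma not_shatters_traces:
  fixes X :: "'a::euclidean_space set"
  assumes S: "S \<subseteq> X \<times> {..<r}" and card: "card S = (DIM('a) + 1) * (r - 1) + 1"
  shows "\<not> shatters (traces r X) S"
proof
  assume sh: "shatters (traces r X) S"
  define E where "E = insert None (Some ` (Basis :: 'a set)) \<times> {1..<r}"
  have finS: "finite S" using card by (intro card_ge_0_finite) simp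
  have "card E = (DIM('a) + 1) * (r - 1)"
    by (simp add: E_def card_cartesian_product card_image)
  then have "card E < card S" using card by linarith
  moreover have "finite E" by (simp add: E_def)
  ultimately obtain c where c: "\<exists>s\<in>S. c s \<noteq> 0" "\<And>e. e \<in> E \<Longrightarrow> (\<Sum>s\<in>S. c s * trace_coord s e) = 0"
    using linear_dependence[of E S trace_coord] finS by blast
  \<comment> \<open>Outside \<open>P\<close> the functional is only known to be nonnegative and may
    vanish, so strictness must come from a positive coefficient; a change of sign provides
    one.\<close>
  obtain c where c: "\<exists>s\<in>S. c s > 0" "\<And>e. e \<in> E \<Longrightarrow> (\<Sum>s\<in>S. c s * trace_coord s e) = 0"
  proof (cases "\<exists>s\<in>S. c s > 0")
    case False
    then have "\<exists>s\<in>S. - c s > 0" using c(1) by force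
    then show ?thesis using that[of "\<lambda>s. - c s"] c(2) by (simp add: sum_negf)
  qed (use that c in blast)
  txt \<open>A functional negative exactly where \<open>c\<close> is positive contradicts the dependence \<open>c\<close>.\<close>
  define P where "P = {s \<in> S. c s > 0}"
  have "P \<subseteq> S" by (auto simp: P_def)
  then obtain B where B: "B \<in> traces r X" "B \<inter> S = P"
    using sh unfolding shatters_def by blast
  then obtain a b where ab: "(\<Sum>i<r. a i) = 0" "(\<Sum>i<r. b i) = 0" "B = open_trace r X a b"
    unfolding traces_def by blast
  define L where "L s = a (snd s) \<bullet> fst s - b (snd s)" for s
  define v where "v e = (case fst e of None \<Rightarrow> b (snd e) | Some u \<Rightarrow> a (snd e) \<bullet> u)" for e
  have mem: "s \<in> P \<longleftrightarrow> L s < 0" if "s \<in> S" for s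
    using B(2) that S ab(3) by (auto simp: open_trace_def L_def)
  have "(\<Sum>s\<in>S. c s * L s) = (\<Sum>s\<in>S. c s * (\<Sum>e\<in>E. trace_coord s e * v e))"
  proof (intro sum.cong refl)
    fix s assume "s \<in> S"
    then have "snd s < r" using S by auto
    from functional_eq_sum_trace_coord[OF ab(1,2) this, of "fst s"]
    show "c s * L s = c s * (\<Sum>e\<in>E. trace_coord s e * v e)"
      by (simp add: L_def E_def v_def)
  qed
  also have "\<dots> = (\<Sum>e\<in>E. (\<Sum>s\<in>S. c s * trace_coord s e) * v e)"
    by (simp only: sum_distrib_left sum_distrib_right mult.assoc) (rule sum.swap)
  also have "\<dots> = 0" using c(2) by (intro sum.neutral) simp
  finally have "(\<Sum>s\<in>S. c s * L s) = 0" .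
  moreover have "(\<Sum>s\<in>S. - (c s * L s)) > 0"
  proof -
    obtain s where s: "s \<in> S" "c s > 0" using c(1) by blast
    then have "L s < 0" using mem[of s] by (simp add: P_def)
    then have "0 < - (c s * L s)" using s(2) by (simp add: mult_pos_neg)
    moreover have "0 \<le> - (c t * L t)" if "t \<in> S" for t
    proof (cases "c t > 0")
      case True
      then have "L t < 0" using mem[OF that] that by (simp add: P_def)
      then show ?thesis using True by (simp add: mult_nonneg_nonpos)
    next
      case False
      then have "L t \<ge> 0" using mem[OF that] by (simp add: P_def)
      then show ?thesis using False by (simp add: mult_nonpos_nonneg)
    qed
    ultimately show ?thesis using s(1) finS by (intro sum_pos2[of S s]) auto
  qed
  ultimately show False by (simp add: sum_negf)
qed

lemma card_traces_le:
  fixes X :: "'a::euclidean_space set"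
  assumes "finite X"
  shows "finite (traces r X)"
    and "card (traces r X) \<le> (\<Sum>i\<le>(DIM('a) + 1) * (r - 1). (card X * r) choose i)"
proof -
  have sub: "traces r X \<subseteq> Pow (X \<times> {..<r})" by (auto simp: traces_def open_trace_def)
  show "finite (traces r X)" using assms by (intro finite_subset[OF sub]) simp
  have "card (traces r X) \<le> (\<Sum>i\<le>(DIM('a) + 1) * (r - 1). card (X \<times> {..<r}) choose i)"
    using assms by (intro sauer_shelah sub not_shatters_traces) auto
  then show "card (traces r X) \<le> (\<Sum>i\<le>(DIM('a) + 1) * (r - 1). (card X * r) choose i)"
    by (simp add: card_cartesian_product)
qed

subsection \<open>Random permutations\<close>

lemma finite_hit_probs: "finite {hit_prob r T | T. admissible_matrix r d T}"
proof -
  define Q where "Q = {\<sigma>. \<sigma> permutes {..<r}}"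
  have "id \<in> Q" by (simp add: Q_def permutes_id)
  then have Q: "finite Q" "Q \<noteq> {}" by (auto simp only: Q_def finite_permutations finite_lessThan)
  have "hit_prob r T \<in> (\<lambda>A. card A / card Q) ` Pow Q" for T
    using measure_pmf_of_set[OF Q(2,1)] by (auto simp: hit_prob_def Q_def[symmetric])
  then have "{hit_prob r T | T. admissible_matrix r d T} \<subseteq> (\<lambda>A. card A / card Q) ` Pow Q" by blast
  then show ?thesis by (rule finite_subset) (simp add: Q)
qed

lemma q_le_hit_prob: "admissible_matrix r d T \<Longrightarrow> q r d \<le> hit_prob r T"
  unfolding q_def by (intro Min_le finite_hit_probs) blast

lemma q_le_1: assumes "d + 1 \<le> r" shows "q r d \<le> 1"
proof -
  have "admissible_matrix r d (\<lambda>_ _. 1)"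
    unfolding admissible_matrix_def using assms
    by (intro conjI exI[of _ "{..<d+1}"]) (auto intro: exI[of _ 0])
  then have "q r d \<le> hit_prob r (\<lambda>_ _. 1)" by (rule q_le_hit_prob)
  also have "\<dots> \<le> 1" by (simp add: hit_prob_def)
  finally show ?thesis .
qed

lemma balanced_halfspaces_disjoint:
  fixes a :: "nat \<Rightarrow> 'a::euclidean_space"
  assumes "(\<Sum>i<r. a i) = 0" "(\<Sum>i<r. b i) = 0" "0 < r"
  shows "(\<Inter>i<r. {x. a i \<bullet> x < b i}) = {}"
proof (rule ccontr)
  assume "\<not> ?thesis"
  then obtain x where x: "\<And>i. i < r \<Longrightarrow> a i \<bullet> x < b i" by auto
  have "(\<Sum>i<r. a i \<bullet> x) < (\<Sum>i<r. b i)"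
    using x assms(3) by (intro sum_strict_mono) (auto simp: lessThan_empty_iff)
  then show False using assms(1,2) by (simp flip: inner_sum_left)
qed

text \<open>Put 1 in row \<open>i\<close>, column \<open>m\<close> when point \<open>m\<close>
  misses half-space \<open>i\<close>: a permutation places every point correctly iff it hits no 1.
  By Helly some \<open>d + 1\<close> of the open half-spaces have no common point, so every column
  has a 1 in those rows and the matrix is admissible.\<close>

lemma prob_all_in_trace_le:
  fixes p :: "nat \<Rightarrow> 'a::euclidean_space"
  assumes S: "S \<in> traces r X" and r: "DIM('a) + 1 \<le> r"
  shows "measure_pmf.prob (pmf_of_set {\<sigma>. \<sigma> permutes {..<r}}) {\<sigma>. \<forall>i<r. (p (\<sigma> i), i) \<in> S}
    \<le> 1 - q r DIM('a)"
proof -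
  obtain a b where ab: "(\<Sum>i<r. a i) = 0" "(\<Sum>i<r. b i) = 0" "S = open_trace r X a b"
    using S unfolding traces_def by blast
  define T where "T i m = (if (p m, i) \<in> S then 0 else 1 :: nat)" for i m
  define U where "U i = {x. a i \<bullet> x < b i}" for i
  have "(\<Inter>i<r. U i) = {}"
    using balanced_halfspaces_disjoint[OF ab(1,2)] r by (simp add: U_def)
  then obtain I where I: "I \<subseteq> {..<r}" "card I = DIM('a) + 1" "(\<Inter>i\<in>I. U i) = {}"
    using indexed_Helly[of r U] r by (auto simp: U_def convex_halfspace_lt)
  have hit: "\<exists>i\<in>I. T i m \<noteq> 0" for m
  proof -
    have "p m \<notin> (\<Inter>i\<in>I. U i)" using I(3) by simp
    then obtain i where "i \<in> I" "p m \<notin> U i" by blast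
    then have "T i m \<noteq> 0" by (simp add: T_def ab(3) open_trace_def U_def)
    then show ?thesis using \<open>i \<in> I\<close> by blast
  qed
  then have "admissible_matrix r DIM('a) T" unfolding admissible_matrix_def
  proof (intro conjI exI[of _ I] allI impI)
    show "T i j \<in> {0, 1}" for i j by (simp add: T_def)
    show "\<exists>i<r. T i m \<noteq> 0" for m using hit[of m] I(1) by blast
  qed (use I hit in auto)
  then have "q r DIM('a) \<le> hit_prob r T" by (rule q_le_hit_prob)
  moreover have "{\<sigma>. \<forall>i<r. (p (\<sigma> i), i) \<in> S} = space (measure_pmf (pmf_of_set {\<sigma>. \<sigma> permutes {..<r}}))
      - {\<sigma>. \<exists>i<r. T i (\<sigma> i) = 1}" by (auto simp: T_def)
  then have "measure_pmf.prob (pmf_of_set {\<sigma>. \<sigma> permutes {..<r}}) {\<sigma>. \<forall>i<r. (p (\<sigma> i), i) \<in> S}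
      = 1 - hit_prob r T"
    by (simp only: hit_prob_def) (rule measure_pmf.prob_compl, simp)
  ultimately show ?thesis by simp
qed

text \<open>Only an upper bound \<open>u\<close> on the individual probabilities is known, so the
  deviation is measured from \<open>u * card J\<close>, which is at least the mean.\<close>

lemma Pi_pmf_count_tail:
  fixes E :: "'i \<Rightarrow> 'b set"
  assumes A: "finite A" and J: "J \<subseteq> A" "J \<noteq> {}"
    and u: "\<And>j. j \<in> J \<Longrightarrow> measure_pmf.prob (p j) (E j) \<le> u" and l: "0 \<le> l"
  shows "measure_pmf.prob (Pi_pmf A d p) {\<sigma>. u * card J + l \<le> card {j \<in> J. \<sigma> j \<in> E j}}
    \<le> exp (- 2 * l\<^sup>2 / card J)"
proof -
  define X :: "'i \<Rightarrow> ('i \<Rightarrow> 'b) \<Rightarrow> real" where "X j \<sigma> = indicator (E j) (\<sigma> j)" for j \<sigma>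
  define \<mu> where "\<mu> = (\<Sum>j\<in>J. measure_pmf.expectation (Pi_pmf A d p) (X j))"
  have finJ: "finite J" using A J finite_subset by blast
  have "measure_pmf.expectation (Pi_pmf A d p) (X j) = measure_pmf.prob (p j) (E j)" if "j \<in> J" for j
  proof -
    have "X j = indicator ((\<lambda>\<sigma>. \<sigma> j) -` E j)" by (auto simp: X_def indicator_def fun_eq_iff)
    then have "measure_pmf.expectation (Pi_pmf A d p) (X j)
      = measure_pmf.prob (map_pmf (\<lambda>\<sigma>. \<sigma> j) (Pi_pmf A d p)) (E j)" by simp
    also have "\<dots> = measure_pmf.prob (p j) (E j)"
      using that J(1) by (subst Pi_pmf_component[OF A]) (auto simp: subset_iff)
    finally show ?thesis .
  qed
  then have mu: "\<mu> \<le> u * card J"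
    using sum_bounded_above[of J "\<lambda>j. measure_pmf.prob (p j) (E j)" u] u by (simp add: \<mu>_def mult.commute)
  interpret Hoeffding_ineq "measure_pmf (Pi_pmf A d p)" J X "\<lambda>_. 0" "\<lambda>_. 1" \<mu>
  proof unfold_locales
    have "prob_space.indep_vars (measure_pmf (Pi_pmf A d p)) (\<lambda>_. count_space UNIV) (\<lambda>x f. f x) J"
      by (rule prob_space.indep_vars_subset[OF measure_pmf.prob_space_axioms indep_vars_Pi_pmf[OF A] J(1)])
    then show "prob_space.indep_vars (measure_pmf (Pi_pmf A d p)) (\<lambda>_. borel) X J"
      unfolding X_def by (rule prob_space.indep_vars_compose2[OF measure_pmf.prob_space_axioms]) simp
  qed (auto simp: finJ \<mu>_def X_def indicator_def)
  have sum_X: "(\<Sum>j\<in>J. X j \<sigma>) = card {j \<in> J. \<sigma> j \<in> E j}" for \<sigma>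
    using finJ by (simp add: X_def indicator_def sum.If_cases Int_def)
  have "measure_pmf.prob (Pi_pmf A d p) {\<sigma>. u * card J + l \<le> card {j \<in> J. \<sigma> j \<in> E j}}
      \<le> measure_pmf.prob (Pi_pmf A d p) {\<sigma>\<in>space (measure_pmf (Pi_pmf A d p)). (\<Sum>j\<in>J. X j \<sigma>) \<ge> \<mu> + l}"
    using mu by (intro measure_pmf.finite_measure_mono) (auto simp: sum_X)
  also have "\<dots> \<le> exp (- 2 * l\<^sup>2 / (\<Sum>j\<in>J. (1 - 0)\<^sup>2))"
    using J finJ by (intro Hoeffding_ineq_ge l) (simp add: card_gt_0_iff)
  finally show ?thesis by simp
qed

section \<open>Simultaneous splitting and the quantity \<open>max_split\<close>\<close>

lemma finite_split_counts:
  fixes C :: "nat \<Rightarrow> 'a::euclidean_space set"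
  shows "finite {card {j \<in> {..<N}. can_split r H (C j)} | H. halfspace_family r H \<and> (\<Inter>i<r. H i) = {}}"
proof -
  have "card {j \<in> {..<N}. P j} \<le> N" for P
    using card_mono[of "{..<N}" "{j \<in> {..<N}. P j}"] by auto
  then show ?thesis by (intro finite_subset[OF _ finite_atMost[of N]]) auto
qed

text \<open>For each class in question fix one permutation that places it inside the trace. For each
  \<open>i\<close>, the hull of the points placed at \<open>i\<close> stays in the
  \<open>i\<close>-th open half-space, so these hulls have no common point; closed half-spaces
  separating them split all these classes at once.\<close>

lemma card_containable_le_max_split:
  fixes C :: "nat \<Rightarrow> 'a::euclidean_space set"
  assumes C: "color_classes N r C" and p: "\<And>j. j < N \<Longrightarrow> bij_betw (p j) {..<r} (C j)"
    and S: "S \<in> traces r X" and r: "0 < r"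
  shows "card {j\<in>{..<N}. \<exists>\<sigma>. \<sigma> permutes {..<r} \<and> (\<forall>i<r. (p j (\<sigma> i), i) \<in> S)} \<le> max_split N r C"
proof -
  define J where "J = {j\<in>{..<N}. \<exists>\<sigma>. \<sigma> permutes {..<r} \<and> (\<forall>i<r. (p j (\<sigma> i), i) \<in> S)}"
  show ?thesis
  proof (cases "J = {}")
    case False
    obtain s where s: "\<And>j. j \<in> J \<Longrightarrow> s j permutes {..<r}"
      "\<And>i j. j \<in> J \<Longrightarrow> i < r \<Longrightarrow> (p j (s j i), i) \<in> S"
    proof -
      have "\<forall>j\<in>J. \<exists>\<sigma>. \<sigma> permutes {..<r} \<and> (\<forall>i<r. (p j (\<sigma> i), i) \<in> S)" by (simp add: J_def)
      from bchoice[OF this] show ?thesis using that by blast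
    qed
    obtain a b where ab: "(\<Sum>i<r. a i) = 0" "(\<Sum>i<r. b i) = 0" "S = open_trace r X a b"
      using S unfolding traces_def by blast
    define K where "K i = convex hull ((\<lambda>j. p j (s j i)) ` J)" for i
    have finJ: "finite J" by (simp add: J_def)
    have K: "K i \<subseteq> {x. a i \<bullet> x < b i}" if "i < r" for i
      unfolding K_def using s(2)[OF _ that] by (intro hull_minimal convex_halfspace_lt) (auto simp: ab(3) open_trace_def)
    have "(\<Inter>i<r. K i) \<subseteq> (\<Inter>i<r. {x. a i \<bullet> x < b i})" using K by blast
    then have "(\<Inter>i<r. K i) = {}" using balanced_halfspaces_disjoint[OF ab(1,2) r] by simp
    moreover have "convex (K i)" "compact (K i)" "K i \<noteq> {}" for i
      using finJ False by (simp_all add: K_def finite_imp_compact_convex_hull)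
    ultimately obtain H where H: "halfspace_family r H" "(\<Inter>i<r. H i) = {}" "\<And>i. i < r \<Longrightarrow> K i \<subseteq> H i"
      using separating_closed_halfspaces[of r K] by blast
    have "can_split r H (C j)" if j: "j \<in> J" for j
    proof -
      have jN: "j < N" using j by (simp add: J_def)
      have "bij_betw (p j \<circ> s j) {..<r} (C j)"
        using bij_betw_trans[OF permutes_imp_bij[OF s(1)[OF j]] p[OF jN]] .
      moreover have "(p j \<circ> s j) i \<in> H i" if "i < r" for i
      proof -
        have "p j (s j i) \<in> K i" unfolding K_def using j by (intro hull_inc) simp
        then show ?thesis using H(3)[OF that] by auto
      qed
      ultimately show ?thesis
        using C jN H(2) by (subst can_split_iff) (auto simp: color_classes_def)
    qed
    then have "card J \<le> card {j \<in> {..<N}. can_split r H (C j)}"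
      by (intro card_mono) (auto simp: J_def)
    also have "\<dots> \<le> max_split N r C"
      unfolding max_split_def using H by (intro Max_ge finite_split_counts) blast
    finally show ?thesis by (simp add: J_def)
  qed (simp only: J_def[symmetric], simp)
qed

lemma max_split_attained:
  fixes C :: "nat \<Rightarrow> 'a::euclidean_space set"
  assumes r: "2 \<le> r"
  obtains H where "halfspace_family r H" "(\<Inter>i<r. H i) = {}"
    "card {j \<in> {..<N}. can_split r H (C j)} = max_split N r C"
proof -
  define F where "F = {card {j \<in> {..<N}. can_split r H (C j)} | H. halfspace_family r H \<and> (\<Inter>i<r. H i) = {}}"
  obtain e :: 'a where e: "e \<in> Basis" using nonempty_Basis by blast
  \<comment> \<open>Two disjoint parallel half-spaces, at indices 0 and 1, witness that the set
    under \<open>Max\<close> is nonempty; this uses \<open>2 \<le> r\<close>.\<close>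
  define H where "H i = (if i = 0 then {x. e \<bullet> x \<le> -1} else {x. (- e) \<bullet> x \<le> 0})" for i :: nat
  have "e \<noteq> 0" using e by auto
  then have "closed_halfspace (H i)" for i
    unfolding closed_halfspace_def H_def
    by (metis neg_equal_0_iff_equal)
  then have "halfspace_family r H" by (simp add: halfspace_family_def)
  moreover have "(\<Inter>i<r. H i) = {}"
  proof -
    have "(\<Inter>i<r. H i) \<subseteq> H 0 \<inter> H 1" using r by auto
    also have "\<dots> = {}" by (auto simp: H_def)
    finally show ?thesis by blast
  qed
  ultimately have "F \<noteq> {}" by (auto simp: F_def)
  then have "max_split N r C \<in> F"
    unfolding max_split_def F_def[symmetric] using finite_split_counts[of N r C] by (intro Max_in) (auto simp: F_def)
  then show ?thesis using that by (auto simp: F_def)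
qed

subsection \<open>Robust colorful partitions\<close>

text \<open>With \<open>g j\<close> a bijection from \<open>{..<r}\<close> onto class
  \<open>j\<close>, the point \<open>g j i\<close> is the one that class \<open>j\<close>
  contributes to part \<open>i\<close>.\<close>

definition transversal_part :: "nat \<Rightarrow> (nat \<Rightarrow> nat \<Rightarrow> 'a) \<Rightarrow> nat \<Rightarrow> 'a set"
  where "transversal_part N g i = (\<lambda>j. g j i) ` {..<N}"

lemma color_class_unique:
  assumes "color_classes N r C" "x \<in> C j" "x \<in> C k" "j < N" "k < N"
  shows "j = k"
  using assms unfolding color_classes_def disjoint_family_on_def by blast

lemma transversal_part_Int:
  assumes C: "color_classes N r C" and g: "\<And>j. j < N \<Longrightarrow> bij_betw (g j) {..<r} (C j)"
    and i: "i < r" and j: "j < N"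
  shows "transversal_part N g i \<inter> C j = {g j i}"
proof -
  have gC: "g k i \<in> C k" if "k < N" for k using bij_betwE[OF g[OF that]] i by simp
  have "k = j" if "k < N" "g k i \<in> C j" for k
    using color_class_unique[OF C gC that(2) _ j] that(1) by blast
  then show ?thesis using gC[OF j] j unfolding transversal_part_def by blast
qed

lemma transversal_part_Diff:
  assumes C: "color_classes N r C" and g: "\<And>j. j < N \<Longrightarrow> bij_betw (g j) {..<r} (C j)"
    and i: "i < r" and R: "R \<subseteq> {..<N}"
  shows "transversal_part N g i - (\<Union>j\<in>R. C j) = (\<lambda>j. g j i) ` ({..<N} - R)"
proof -
  have gC: "g k i \<in> C k" if "k < N" for k using bij_betwE[OF g[OF that]] i by simp
  have "k = j" if "k < N" "j \<in> R" "g k i \<in> C j" for k j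
    using color_class_unique[OF C gC that(3)] that(1,2) R by blast
  then have "g k i \<in> (\<Union>j\<in>R. C j) \<longleftrightarrow> k \<in> R" if "k < N" for k using that gC by blast
  then show ?thesis unfolding transversal_part_def by auto
qed

lemma colorful_transversal_parts:
  assumes N: "1 \<le> N" and C: "color_classes N r C"
    and g: "\<And>j. j < N \<Longrightarrow> bij_betw (g j) {..<r} (C j)"
  shows "colorful_partition N r C (transversal_part N g ` {..<r})"
proof -
  let ?A = "transversal_part N g"
  have int: "?A i \<inter> C j = {g j i}" if "i < r" "j < N" for i j
    using transversal_part_Int[OF C g that] .
  have ne: "?A i \<noteq> {}" for i using N by (auto simp: transversal_part_def lessThan_empty_iff)
  have disj: "i = k" if x: "x \<in> ?A i" "x \<in> ?A k" and ik: "i < r" "k < r" for x i k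
  proof -
    obtain j where j: "j < N" "x = g j i" using x(1) by (auto simp: transversal_part_def)
    have "x \<in> C j" using j bij_betwE[OF g] ik by blast
    then have "x = g j k" using int[OF ik(2) j(1)] x(2) by blast
    then show ?thesis using j bij_betw_imp_inj_on[OF g[OF j(1)]] ik by (auto simp: inj_on_def)
  qed
  have "inj_on ?A {..<r}"
  proof (rule inj_onI)
    fix i k assume ik: "i \<in> {..<r}" "k \<in> {..<r}" "?A i = ?A k"
    obtain x where "x \<in> ?A i" using ne by blast
    then show "i = k" using disj ik by auto
  qed
  then have "card (?A ` {..<r}) = r" by (simp add: card_image)
  moreover have "partition_on (\<Union>j<N. C j) (?A ` {..<r})"
  proof (rule partition_onI)
    show "\<Union> (?A ` {..<r}) = (\<Union>j<N. C j)"
    proof -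
      have "(\<Union>i<r. ?A i) = (\<Union>j<N. g j ` {..<r})" by (auto simp: transversal_part_def)
      also have "\<dots> = (\<Union>j<N. C j)" using bij_betw_imp_surj_on[OF g] by auto
      finally show ?thesis .
    qed
    show "disjnt X Y" if XY: "X \<in> ?A ` {..<r}" "Y \<in> ?A ` {..<r}" "X \<noteq> Y" for X Y
    proof -
      obtain i k where ik: "i < r" "k < r" "X = ?A i" "Y = ?A k" using XY by blast
      then show ?thesis using disj[OF _ _ ik(1,2)] XY(3) unfolding disjnt_def by blast
    qed
  qed (use ne in auto)
  moreover have "\<forall>A\<in>?A ` {..<r}. \<forall>j<N. card (A \<inter> C j) = 1"
    using int by auto
  ultimately show ?thesis unfolding colorful_partition_def by blast
qed

text \<open>If the surviving hulls had no common point, separating them would give a trace capturing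
  all \<open>N - card R\<close> surviving classes. The inclusion of \<open>R\<close> is proper to
  keep these hulls nonempty.\<close>

lemma is_tverberg_remove_transversals:
  fixes C :: "nat \<Rightarrow> 'a::euclidean_space set"
  assumes C: "color_classes N r C" and g: "\<And>j. j < N \<Longrightarrow> bij_betw (g j) {..<r} (C j)"
    and r: "0 < r" and R: "R \<subset> {..<N}"
    and few: "\<And>S. S \<in> traces r (\<Union>j<N. C j) \<Longrightarrow>
      card {j\<in>{..<N}. \<forall>i<r. (g j i, i) \<in> S} < N - card R"
  shows "is_tverberg (remove_classes C R (transversal_part N g ` {..<r}))"
proof (rule ccontr)
  define Q where "Q = {..<N} - R"
  define K where "K i = convex hull ((\<lambda>j. g j i) ` Q)" for i
  have Q: "finite Q" "Q \<noteq> {}" using R by (auto simp: Q_def)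
  have "(\<Inter>A\<in>remove_classes C R (transversal_part N g ` {..<r}). convex hull A) = (\<Inter>i<r. K i)"
    using transversal_part_Diff[OF C g _ psubset_imp_subset[OF R]]
    by (simp add: remove_classes_def K_def Q_def)
  moreover assume "\<not> is_tverberg (remove_classes C R (transversal_part N g ` {..<r}))"
  ultimately have "(\<Inter>i<r. K i) = {}" by (simp add: is_tverberg_def)
  moreover have "convex (K i)" "compact (K i)" "K i \<noteq> {}" for i
    using Q by (simp_all add: K_def finite_imp_compact_convex_hull)
  ultimately obtain a b where ab: "(\<Sum>i<r. a i) = 0" "(\<Sum>i<r. b i) = 0"
      "\<And>i x. i < r \<Longrightarrow> x \<in> K i \<Longrightarrow> a i \<bullet> x < b i"
    using separating_open_halfspaces[of "{..<r}" K] by (metis finite_lessThan lessThan_iff)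
  define S where "S = open_trace r (\<Union>j<N. C j) a b"
  have "(g j i, i) \<in> S" if "j \<in> Q" "i < r" for i j
  proof -
    have "g j i \<in> K i" unfolding K_def using that by (intro hull_inc) simp
    moreover have "j < N" using that by (simp add: Q_def)
    ultimately show ?thesis
      using ab(3) that(2) bij_betwE[OF g[of j]] by (auto simp: S_def open_trace_def)
  qed
  then have "card Q \<le> card {j\<in>{..<N}. \<forall>i<r. (g j i, i) \<in> S}"
    by (intro card_mono) (auto simp: Q_def)
  moreover have "card Q = N - card R"
    using R finite_subset[of R "{..<N}"] by (simp add: Q_def card_Diff_subset psubset_imp_subset)
  moreover have "S \<in> traces r (\<Union>j<N. C j)" using ab by (auto simp: S_def traces_def)
  ultimately show False using few[of S] by linarith
qed

lemma card_color_classes_Union: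
  assumes "color_classes N r C"
  shows "card (\<Union>j<N. C j) = N * r" "finite (\<Union>j<N. C j)"
proof -
  have "card (\<Union>j<N. C j) = (\<Sum>j<N. card (C j))"
    using assms by (intro card_UN_disjoint') (auto simp: color_classes_def)
  then show "card (\<Union>j<N. C j) = N * r" using assms by (simp add: color_classes_def)
qed (use assms in \<open>auto simp: color_classes_def\<close>)

lemma exists_robust_partition:
  fixes C :: "nat \<Rightarrow> 'a::euclidean_space set"
  assumes N: "1 \<le> N" and r: "DIM('a) + 1 < r" and C: "color_classes N r C"
  defines "f \<equiv> real (max_split N r C)"
  shows "\<exists>P. colorful_partition N r C P \<and>
    (\<forall>t::nat. real t \<le> real N - (1 - q r DIM('a)) * f
         - sqrt ((real DIM('a) + 1) * (real r - 1) * f * ln (real N * real r ^ 2) / 2) - 1 \<longrightarrow>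
       (\<forall>R. R \<subseteq> {..<N} \<and> card R = t \<longrightarrow> is_tverberg (remove_classes C R P)))"
proof -
  define n where "n = (DIM('a) + 1) * (r - 1)"
  define M where "M = N * r\<^sup>2"
  define u where "u = 1 - q r DIM('a)"
  \<comment> \<open>Chosen so that \<open>2 * l\<^sup>2 = n * f * ln M\<close>; then
    \<open>exp (- 2 * l\<^sup>2 / k) \<le> 1 / M ^ n\<close> whenever
    \<open>0 < k \<le> f\<close>.\<close>
  define l where "l = sqrt (real n * f * ln (real M) / 2)"
  define X where "X = (\<Union>j<N. C j)"
  define Perms where "Perms = {\<sigma>. \<sigma> permutes {..<r}}"
  define D where "D = Pi_pmf {..<N} id (\<lambda>_. pmf_of_set Perms)"
  have D0: "DIM('a) \<ge> 1" using DIM_positive[where 'a='a] by linarith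
  have r3: "r \<ge> 3" using r D0 by linarith
  have r0: "0 < r" and rD: "DIM('a) + 1 \<le> r" using r by simp_all
  have u0: "0 \<le> u" using q_le_1[OF rD] by (simp add: u_def)
  have f0: "0 \<le> f" by (simp add: f_def)
  have n2: "2 \<le> n" using mult_le_mono[of 2 "DIM('a) + 1" 1 "r - 1"] D0 r3 by (simp add: n_def)
  have M4: "4 \<le> M"
  proof -
    have "3 * 3 \<le> r * r" using r3 by (intro mult_le_mono)
    then have "1 * 4 \<le> N * (r * r)" using N by (intro mult_le_mono) simp_all
    then show ?thesis by (simp add: M_def power2_eq_square)
  qed
  have l0: "0 \<le> l" using f0 M4 by (simp add: l_def)
  have "id \<in> Perms" by (simp add: Perms_def permutes_id)
  then have Perms: "finite Perms" "Perms \<noteq> {}" by (auto simp only: Perms_def finite_permutations finite_lessThan)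
  have "\<forall>j\<in>{..<N}. \<exists>h. bij_betw h {..<r} (C j)"
    using C ex_bij_betw_nat_finite[of "C j" for j]
    by (auto simp: color_classes_def lessThan_atLeast0)
  from bchoice[OF this] obtain p where p: "\<And>j. j < N \<Longrightarrow> bij_betw (p j) {..<r} (C j)" by auto
  have supp: "\<sigma> j permutes {..<r}" if "\<sigma> \<in> set_pmf D" "j < N" for \<sigma> j
    using that Perms by (auto simp: D_def set_Pi_pmf PiE_dflt_def Perms_def)
  define E where "E S j = {\<tau>. \<forall>i<r. (p j (\<tau> i), i) \<in> S}" for S j
  define bad where "bad S = {\<sigma>. u * f + l + 1 \<le> real (card {j\<in>{..<N}. \<sigma> j \<in> E S j})}" for S
  have bad: "measure_pmf.prob D (bad S) \<le> 1 / real M ^ n" if S: "S \<in> traces r X" for S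
  proof -
    define J where "J = {j\<in>{..<N}. \<exists>\<tau>. \<tau> permutes {..<r} \<and> (\<forall>i<r. (p j (\<tau> i), i) \<in> S)}"
    have J: "J \<subseteq> {..<N}" by (auto simp: J_def)
    have Jf: "card J \<le> f"
      using card_containable_le_max_split[OF C p S r0] by (simp add: f_def J_def)
    \<comment> \<open>Classes outside \<open>J\<close> are never captured, so only
      \<open>card J \<le> f\<close> trials count. The equality needs each \<open>\<sigma> j\<close>
      to be a permutation, hence holds on the support of \<open>D\<close> only.\<close>
    have eq: "{j\<in>{..<N}. \<sigma> j \<in> E S j} = {j\<in>J. \<sigma> j \<in> E S j}" if "\<sigma> \<in> set_pmf D" for \<sigma>
      using supp[OF that] by (auto simp: J_def E_def)
    show ?thesis
    proof (cases "J = {}")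
      \<comment> \<open>Hoeffding's inequality needs at least one trial. Here the count is 0, and
        the summand 1 in \<open>bad\<close> excludes the event even if
        \<open>u * f + l = 0\<close>.\<close>
      case True
      have "\<sigma> \<notin> bad S" if "\<sigma> \<in> set_pmf D" for \<sigma>
        unfolding bad_def mem_Collect_eq eq[OF that] using True mult_nonneg_nonneg[OF u0 f0] l0 by simp
      then have "measure_pmf.prob D (bad S) = 0" by (auto simp: measure_pmf_zero_iff)
      then show ?thesis by simp
    next
      case False
      have Jpos: "0 < real (card J)" using False finite_subset[OF J] by (simp add: card_gt_0_iff)
      have "measure_pmf.prob D (bad S)
          \<le> measure_pmf.prob D {\<sigma>. u * card J + l \<le> card {j \<in> J. \<sigma> j \<in> E S j}}"
      proof (rule measure_pmf.finite_measure_mono_AE)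
        show "AE \<sigma> in measure_pmf D. \<sigma> \<in> bad S \<longrightarrow>
            \<sigma> \<in> {\<sigma>. u * card J + l \<le> card {j \<in> J. \<sigma> j \<in> E S j}}"
          using mult_left_mono[OF Jf u0] eq by (auto simp: AE_measure_pmf_iff bad_def)
      qed simp
      also have "\<dots> \<le> exp (- 2 * l\<^sup>2 / card J)"
        unfolding D_def
      proof (rule Pi_pmf_count_tail)
        show "measure_pmf.prob (pmf_of_set Perms) (E S j) \<le> u" for j
          unfolding E_def u_def Perms_def by (rule prob_all_in_trace_le[OF S rD])
      qed (use J False l0 in auto)
      also have "\<dots> \<le> exp (- (real n * ln (real M)))"
      proof -
        have "real n * ln (real M) * card J \<le> real n * ln (real M) * f"
          using Jf M4 by (intro mult_left_mono) auto
        also have "\<dots> = 2 * l\<^sup>2" using f0 M4 by (simp add: l_def)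
        finally show ?thesis using Jpos by (simp add: field_simps)
      qed
      also have "\<dots> = 1 / real M ^ n"
        using M4 by (simp add: exp_minus exp_of_nat_mult inverse_eq_divide)
      finally show ?thesis .
    qed
  qed
  have finX: "finite X" and cardX: "card X * r = M"
    using card_color_classes_Union[OF C] by (simp_all add: X_def M_def power2_eq_square)
  have "measure_pmf.prob D (\<Union>S\<in>traces r X. bad S) \<le> (\<Sum>S\<in>traces r X. measure_pmf.prob D (bad S))"
    by (intro measure_pmf.finite_measure_subadditive_finite card_traces_le finX) auto
  also have "\<dots> \<le> (\<Sum>S\<in>traces r X. 1 / real M ^ n)" by (intro sum_mono bad)
  also have "\<dots> = card (traces r X) / real M ^ n" by simp
  also have "\<dots> < 1"
  proof -
    have "card (traces r X) < M ^ n"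
      using card_traces_le(2)[OF finX, of r] sum_choose_less_power[OF M4 n2]
      by (simp only: cardX n_def[symmetric])
    then have "real (card (traces r X)) < real M ^ n" by (metis of_nat_less_iff of_nat_power)
    then show ?thesis using M4 by simp
  qed
  finally have lt1: "measure_pmf.prob D (\<Union>S\<in>traces r X. bad S) < 1" .
  have "\<exists>\<sigma>\<in>set_pmf D. \<sigma> \<notin> (\<Union>S\<in>traces r X. bad S)"
  proof (rule ccontr)
    assume "\<not> ?thesis"
    then have "AE \<sigma> in measure_pmf D. \<sigma> \<in> (\<Union>S\<in>traces r X. bad S)"
      by (auto simp: AE_measure_pmf_iff)
    then have "measure_pmf.prob D (\<Union>S\<in>traces r X. bad S) = 1"
      by (subst measure_pmf.prob_eq_1) auto
    then show False using lt1 by simp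
  qed
  then obtain \<sigma> where \<sigma>: "\<sigma> \<in> set_pmf D"
    "\<And>S. S \<in> traces r X \<Longrightarrow> real (card {j\<in>{..<N}. \<sigma> j \<in> E S j}) < u * f + l + 1"
    by (auto simp: bad_def not_le)
  define g where "g j = p j \<circ> \<sigma> j" for j
  have g: "bij_betw (g j) {..<r} (C j)" if "j < N" for j
    unfolding g_def using bij_betw_trans[OF permutes_imp_bij[OF supp[OF \<sigma>(1) that]] p[OF that]] .
  have leq: "sqrt ((real DIM('a) + 1) * (real r - 1) * f * ln (real N * real r ^ 2) / 2) = l"
  proof -
    have "real n = (real DIM('a) + 1) * (real r - 1)"
      unfolding n_def of_nat_mult using r0 by (simp add: of_nat_diff)
    then show ?thesis by (simp add: l_def M_def)
  qed
  show ?thesis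
  proof (intro exI[of _ "transversal_part N g ` {..<r}"] conjI allI impI)
    show "colorful_partition N r C (transversal_part N g ` {..<r})"
      by (rule colorful_transversal_parts[OF N C g])
    fix t R
    assume t: "real t \<le> real N - (1 - q r DIM('a)) * f
         - sqrt ((real DIM('a) + 1) * (real r - 1) * f * ln (real N * real r ^ 2) / 2) - 1"
      and R: "R \<subseteq> {..<N} \<and> card R = t"
    have t': "u * f + l + 1 \<le> real N - real t" using t unfolding leq u_def by linarith
    \<comment> \<open>The final \<open>- 1\<close> of the bound on \<open>t\<close> guarantees that
      at least one class survives.\<close>
    have tN: "t < N" using t' mult_nonneg_nonneg[OF u0 f0] l0 by linarith
    show "is_tverberg (remove_classes C R (transversal_part N g ` {..<r}))"
    proof (rule is_tverberg_remove_transversals[OF C g r0])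
      show "R \<subset> {..<N}" using R tN by auto
      fix S assume "S \<in> traces r (\<Union>j<N. C j)"
      then have "real (card {j\<in>{..<N}. \<sigma> j \<in> E S j}) < real (N - t)"
        using \<sigma>(2)[of S] t' tN by (simp add: X_def of_nat_diff)
      then show "card {j\<in>{..<N}. \<forall>i<r. (g j i, i) \<in> S} < N - card R"
        using R by (simp add: E_def g_def)
    qed
  qed
qed

section \<open>Destroying an arbitrary colorful partition\<close>

lemma not_robust_partition:
  fixes C :: "nat \<Rightarrow> 'a::euclidean_space set"
  assumes r: "2 \<le> r" and C: "color_classes N r C" and P: "colorful_partition N r C P"
  obtains R where "R \<subseteq> {..<N}" "real (card R) \<le> real N - 1 / fact r * real (max_split N r C)"
    "\<not> is_tverberg (remove_classes C R P)"
proof -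
  obtain H where H: "halfspace_family r H" "(\<Inter>i<r. H i) = {}"
    "card {j \<in> {..<N}. can_split r H (C j)} = max_split N r C"
    using max_split_attained[OF r] by blast
  define J where "J = {j \<in> {..<N}. can_split r H (C j)}"
  define Perms where "Perms = {\<sigma>. \<sigma> permutes {..<r}}"
  have Perms: "finite Perms" "card Perms = fact r"
    by (simp_all add: Perms_def finite_permutations card_permutations)
  have part: "partition_on (\<Union>j<N. C j) P" "card P = r"
    "\<And>A j. A \<in> P \<Longrightarrow> j < N \<Longrightarrow> card (A \<inter> C j) = 1"
    using P by (auto simp: colorful_partition_def)
  have "finite P" using part(2) r by (intro card_ge_0_finite) simp
  then obtain A where A: "bij_betw A {..<r} P"
    using ex_bij_betw_nat_finite[of P] part(2) by (auto simp: lessThan_atLeast0)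
  have "\<exists>\<tau>\<in>Perms. \<forall>i<r. A (\<tau> i) \<inter> C j \<subseteq> H i" if j: "j \<in> J" for j
  proof -
    have jN: "j < N" and "can_split r H (C j)" using j by (auto simp: J_def)
    then obtain f where f: "bij_betw f {..<r} (C j)" "\<And>i. i < r \<Longrightarrow> f i \<in> H i"
      using C can_split_iff[of "C j" r H] by (auto simp: color_classes_def)
    have "\<exists>k<r. f i \<in> A k" if "i < r" for i
    proof -
      have "f i \<in> \<Union>P" using bij_betwE[OF f(1)] that jN partition_onD1[OF part(1)] by blast
      then show ?thesis using bij_betw_imp_surj_on[OF A] by blast
    qed
    then obtain k where k: "\<And>i. i < r \<Longrightarrow> k i < r" "\<And>i. i < r \<Longrightarrow> f i \<in> A (k i)" by metis
    have single: "A (k i) \<inter> C j = {f i}" if "i < r" for i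
    proof -
      have "card (A (k i) \<inter> C j) = 1" using part(3) bij_betwE[OF A] k(1)[OF that] jN by blast
      moreover have "f i \<in> A (k i) \<inter> C j" using k(2)[OF that] bij_betwE[OF f(1)] that by blast
      ultimately show ?thesis by (metis card_1_singletonE singletonD)
    qed
    \<comment> \<open>\<open>\<tau> i\<close> is the part holding the point that the matching
      assigns to \<open>H i\<close>; the identity outside \<open>{..<r}\<close> is required by
      \<open>permutes\<close>.\<close>
    define \<tau> where "\<tau> i = (if i < r then k i else i)" for i
    have "inj_on \<tau> {..<r}"
    proof (rule inj_onI)
      fix i i' assume i: "i \<in> {..<r}" "i' \<in> {..<r}" "\<tau> i = \<tau> i'"
      then have "f i = f i'" using single[of i] single[of i'] by (auto simp: \<tau>_def)
      then show "i = i'" using i bij_betw_imp_inj_on[OF f(1)] by (auto simp: inj_on_def)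
    qed
    moreover have "\<tau> ` {..<r} \<subseteq> {..<r}" using k(1) by (auto simp: \<tau>_def)
    ultimately have "bij_betw \<tau> {..<r} {..<r}"
      using endo_inj_surj[of "{..<r}" \<tau>] by (simp add: bij_betw_def)
    then have "\<tau> permutes {..<r}" by (rule bij_imp_permutes) (simp add: \<tau>_def)
    moreover have "\<forall>i<r. A (\<tau> i) \<inter> C j \<subseteq> H i" using single f(2) by (simp add: \<tau>_def)
    ultimately show ?thesis by (auto simp: Perms_def)
  qed
  then have "\<forall>j\<in>J. \<exists>\<tau>. \<tau> \<in> Perms \<and> (\<forall>i<r. A (\<tau> i) \<inter> C j \<subseteq> H i)" by blast
  from bchoice[OF this] obtain T where T: "\<And>j. j \<in> J \<Longrightarrow> T j \<in> Perms"
    "\<And>i j. j \<in> J \<Longrightarrow> i < r \<Longrightarrow> A (T j i) \<inter> C j \<subseteq> H i" by blast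
  define Q where "Q \<tau> = {j \<in> J. T j = \<tau>}" for \<tau>
  have finJ: "finite J" by (simp add: J_def)
  \<comment> \<open>Pigeonhole: the \<open>fact r\<close> permutations distribute the split classes
    among themselves, so one of them receives at least the average.\<close>
  have "\<exists>\<tau>\<in>Perms. real (card J) / fact r \<le> card (Q \<tau>)"
  proof (rule ccontr)
    assume neg: "\<not> ?thesis"
    have "J = (\<Union>\<tau>\<in>Perms. Q \<tau>)" using T(1) by (auto simp: Q_def)
    then have "card J \<le> (\<Sum>\<tau>\<in>Perms. card (Q \<tau>))" using card_UN_le[OF Perms(1), of Q] by simp
    then have "real (card J) \<le> (\<Sum>\<tau>\<in>Perms. real (card (Q \<tau>)))" by (metis of_nat_le_iff of_nat_sum)
    also have "\<dots> < of_nat (card Perms) * (real (card J) / fact r)"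
      using neg Perms by (intro sum_bounded_above_strict) (auto simp: not_le)
    also have "\<dots> = real (card J)" by (simp add: Perms(2))
    finally show False by simp
  qed
  then obtain \<tau> where \<tau>: "\<tau> \<in> Perms" "real (card J) / fact r \<le> card (Q \<tau>)" by blast
  \<comment> \<open>Keeping only the classes assigned to \<open>\<tau>\<close> leaves part
    \<open>\<tau> i\<close> inside \<open>H i\<close>. If there are none, all classes are removed
    and the emptied parts have empty hulls.\<close>
  define R where "R = {..<N} - Q \<tau>"
  have QN: "Q \<tau> \<subseteq> {..<N}" by (auto simp: Q_def J_def)
  have "card R = N - card (Q \<tau>)"
    using QN finite_subset[OF QN] by (simp add: R_def card_Diff_subset)
  moreover have "card (Q \<tau>) \<le> N" using card_mono[OF _ QN] by simp
  ultimately have "real (card R) \<le> real N - 1 / fact r * real (max_split N r C)"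
    using \<tau>(2) H(3) by (simp add: J_def of_nat_diff)
  moreover have "\<not> is_tverberg (remove_classes C R P)"
  proof -
    have "convex hull (A (\<tau> i) - (\<Union>j\<in>R. C j)) \<subseteq> H i" if i: "i < r" for i
    proof (rule hull_minimal)
      have "\<tau> i < r" using \<tau>(1) i permutes_in_image[of \<tau> "{..<r}" i] by (simp add: Perms_def)
      then have "A (\<tau> i) \<subseteq> (\<Union>j<N. C j)"
        using bij_betwE[OF A] partition_onD1[OF part(1)] by blast
      moreover have "A (\<tau> i) \<inter> C j \<subseteq> H i" if "j \<in> Q \<tau>" for j
        using T(2)[of j i] that i by (simp add: Q_def)
      ultimately show "A (\<tau> i) - (\<Union>j\<in>R. C j) \<subseteq> H i" unfolding R_def by blast
      show "convex (H i)"
        using H(1) i convex_halfspace_le unfolding halfspace_family_def closed_halfspace_def by metis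
    qed
    moreover have "A (\<tau> i) - (\<Union>j\<in>R. C j) \<in> remove_classes C R P" if "i < r" for i
    proof -
      have "\<tau> i < r" using \<tau>(1) that permutes_in_image[of \<tau> "{..<r}" i] by (simp add: Perms_def)
      then show ?thesis using bij_betwE[OF A] by (simp add: remove_classes_def)
    qed
    ultimately have "(\<Inter>B\<in>remove_classes C R P. convex hull B) \<subseteq> (\<Inter>i<r. H i)" by blast
    then show ?thesis using H(2) by (simp add: is_tverberg_def)
  qed
  ultimately show ?thesis using that[of R] by (simp add: R_def)
qed

theorem theorem5p6:
  fixes N r :: nat and C :: "nat \<Rightarrow> (real ^ 'd) set"
  assumes "N \<ge> 1" and "r > CARD('d) + 1"
    and "color_classes N r C"
  shows "(\<exists>P. colorful_partition N r C P \<and>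
            (\<forall>t::nat. real t \<le> real N - (1 - q r CARD('d)) * real (max_split N r C)
                 - sqrt ((real CARD('d) + 1) * (real r - 1) * real (max_split N r C)
                           * ln (real N * real r ^ 2) / 2) - 1 \<longrightarrow>
               (\<forall>R. R \<subseteq> {..<N} \<and> card R = t \<longrightarrow> is_tverberg (remove_classes C R P))))
       \<and> (\<forall>P. colorful_partition N r C P \<longrightarrow>
            (\<exists>R. R \<subseteq> {..<N} \<and> real (card R) \<le> real N - 1 / fact r * real (max_split N r C) \<and>
               \<not> is_tverberg (remove_classes C R P)))"
proof (intro conjI allI impI)
  have dim: "DIM(real ^ 'd) = CARD('d)" by simp
  show "\<exists>P. colorful_partition N r C P \<and>
            (\<forall>t::nat. real t \<le> real N - (1 - q r CARD('d)) * real (max_split N r C)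
                 - sqrt ((real CARD('d) + 1) * (real r - 1) * real (max_split N r C)
                           * ln (real N * real r ^ 2) / 2) - 1 \<longrightarrow>
               (\<forall>R. R \<subseteq> {..<N} \<and> card R = t \<longrightarrow> is_tverberg (remove_classes C R P)))"
    using exists_robust_partition[of N r C, unfolded dim] assms by blast
  fix P assume "colorful_partition N r C P"
  moreover have "2 \<le> r" using assms(2) by simp
  ultimately obtain R where "R \<subseteq> {..<N}"
    "real (card R) \<le> real N - 1 / fact r * real (max_split N r C)"
    "\<not> is_tverberg (remove_classes C R P)"
    using not_robust_partition[of r N C P] assms(3) by blast
  then show "\<exists>R. R \<subseteq> {..<N} \<and> real (card R) \<le> real N - 1 / fact r * real (max_split N r C) \<and>
               \<not> is_tverberg (remove_classes C R P)" by blast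
qed

end
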